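(* Let $X=aF_1+bF_2+cF_3$ with $c\neq0$, normalized (by rescaling $X$, which does not change the one-parameter group it generates) so that $c=1$. Let $V=\eta F_1+\lambda F_2+\mu F_3$ be a Killing vector field, and let $\tilde\eta,\tilde\lambda$ be the constants determined by $V=\mu X+\tilde\eta F_1+\tilde\lambda F_2$, i.e. $\tilde\eta=\eta-\mu a$, $\tilde\lambda=\lambda-\mu b$. Let $\mathcal M$ be an $X$-invariant surface, parametrized by $$\mathcal M(u,s)=\left(a(1-e^{-u})+e^{-u}x(s),\;b(e^{u}-1)+e^{u}y(s),\;u\right),$$ where $\gamma(s)=(x(s),y(s),0)$ is a curve parametrized by arc length. Then $\mathcal M$ is an $X$-invariant translator in the direction of $V$ if and only if $$\tilde\lambda x'=\tilde\eta y'=0.$$ Since $x'$ and $y'$ cannot both be zero, an $X$-invariant translator in the direction of $V$ exists if and only if $\tilde\lambda\tilde\eta=0$. Moreover, if in this case $\tilde\lambda\neq0$ (resp. $\tilde\eta\neq0$), then $x'\equiv0$ (resp. $y'\equiv0$). In the special case $a=b=0$ this means that the only $F_3$-invariant translators are the planes $x\equiv c_0$ and $y\equiv c_0$ for some constant $c_0$.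
   Context: $Sol_3$ is $\mathbb R^3$ with coordinates $(x,y,z)$, group law $(x_1,y_1,z_1)\star(x_2,y_2,z_2)=(x_1+e^{-z_1}x_2,\;y_1+e^{z_1}y_2,\;z_1+z_2)$ and left-invariant metric $\bar g=e^{2z}dx^2+e^{-2z}dy^2+dz^2$. Its Killing vector fields are the constant-coefficient linear combinations of $F_1=\partial_x$, $F_2=\partial_y$, $F_3=-x\partial_x+y\partial_y+\partial_z$. A surface is $X$-invariant if it is invariant under the one-parameter group of isometries generated by the Killing field $X$; for $X=aF_1+bF_2+F_3$ this group consists of the left translations by $(a(1-e^{-t}),b(e^{t}-1),t)$, $t\in\mathbb R$, so an $X$-invariant surface is obtained by applying these translations to a curve $\gamma$ in the plane $z=0$. A surface $\mathcal M$ with unit normal $\nu$ and mean curvature $H$ (sum of the principal curvatures) is a translator in the direction of a Killing field $V$ if $H=\bar g(\nu,V)$. For $X$-invariant surfaces with $c\neq0$, being a translator in the direction of $V$ is equivalent to being minimal with $V$ tangent to the surface.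
   Formalization: If both tilde constants vanish (V=μX) the equivalence fails: translator then means minimal. It is stated for (η̃,λ̃)≠(0,0), plus "translator iff minimal and λ̃x'=η̃y'=0" for all V; the last sentence is for V not a multiple of F3, with x≡c0, y≡c0 read on the generating curve. *)

theory Defs
  imports "HOL-Analysis.Analysis"
begin

section \<open>Surfaces in \<open>\<real>\<^sup>3\<close> with a Riemannian metric\<close>

text \<open>A metric is given by its Gram matrix \<open>g p\<close> with respect to the coordinate frame.\<close>

definition partial :: "'n::finite \<Rightarrow> (real^'n \<Rightarrow> 'b::real_normed_vector) \<Rightarrow> real^'n \<Rightarrow> 'b" where
  "partial i f p = vector_derivative (\<lambda>t. f (p + t *\<^sub>R axis i 1)) (at 0)"

definition metric_ip :: "(real^'n \<Rightarrow> real^'n^'n) \<Rightarrow> real^'n \<Rightarrow> real^'n \<Rightarrow> real^'n \<Rightarrow> real" where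
  "metric_ip g p v w = v \<bullet> (g p *v w)"

text \<open>\<open>christoffel g p k i j\<close> is \<open>\<Gamma>\<^sup>k\<^sub>i\<^sub>j\<close> of the Levi-Civita connection.\<close>

definition christoffel ::
    "(real^'n::finite \<Rightarrow> real^'n^'n) \<Rightarrow> real^'n \<Rightarrow> 'n \<Rightarrow> 'n \<Rightarrow> 'n \<Rightarrow> real" where
  "christoffel g p k i j =
     (1/2) * (\<Sum>l\<in>UNIV. matrix_inv (g p) $ k $ l *
        (partial i (\<lambda>q. g q $ j $ l) p + partial j (\<lambda>q. g q $ i $ l) p
          - partial l (\<lambda>q. g q $ i $ j) p))"

text \<open>The covariant derivative of the coordinate field \<open>\<partial>\<^sub>j\<Phi>\<close> in the direction \<open>\<partial>\<^sub>i\<Phi>\<close>.\<close>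

definition cov_deriv ::
    "(real^3 \<Rightarrow> real^3^3) \<Rightarrow> (real^2 \<Rightarrow> real^3) \<Rightarrow> real^2 \<Rightarrow> 2 \<Rightarrow> 2 \<Rightarrow> real^3" where
  "cov_deriv g \<Phi> p i j =
     partial i (partial j \<Phi>) p +
     (\<chi> k. \<Sum>l\<in>UNIV. \<Sum>m\<in>UNIV.
        christoffel g (\<Phi> p) k l m * partial i \<Phi> p $ l * partial j \<Phi> p $ m)"

definition immersed_on :: "(real^2) set \<Rightarrow> (real^2 \<Rightarrow> real^3) \<Rightarrow> bool" where
  "immersed_on D \<Phi> \<longleftrightarrow>
     (\<forall>p\<in>D. \<forall>c d. c *\<^sub>R partial 1 \<Phi> p + d *\<^sub>R partial 2 \<Phi> p = 0 \<longrightarrow> c = 0 \<and> d = 0)"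

definition unit_normal ::
    "(real^3 \<Rightarrow> real^3^3) \<Rightarrow> (real^2 \<Rightarrow> real^3) \<Rightarrow> real^2 \<Rightarrow> real^3 \<Rightarrow> bool" where
  "unit_normal g \<Phi> p \<nu> \<longleftrightarrow>
     metric_ip g (\<Phi> p) \<nu> \<nu> = 1 \<and> (\<forall>i. metric_ip g (\<Phi> p) \<nu> (partial i \<Phi> p) = 0)"

definition first_form :: "(real^3 \<Rightarrow> real^3^3) \<Rightarrow> (real^2 \<Rightarrow> real^3) \<Rightarrow> real^2 \<Rightarrow> real^2^2" where
  "first_form g \<Phi> p = (\<chi> i j. metric_ip g (\<Phi> p) (partial i \<Phi> p) (partial j \<Phi> p))"

definition second_form ::
    "(real^3 \<Rightarrow> real^3^3) \<Rightarrow> (real^2 \<Rightarrow> real^3) \<Rightarrow> real^2 \<Rightarrow> real^3 \<Rightarrow> real^2^2" where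
  "second_form g \<Phi> p \<nu> = (\<chi> i j. metric_ip g (\<Phi> p) (cov_deriv g \<Phi> p i j) \<nu>)"

definition shape_operator ::
    "(real^3 \<Rightarrow> real^3^3) \<Rightarrow> (real^2 \<Rightarrow> real^3) \<Rightarrow> real^2 \<Rightarrow> real^3 \<Rightarrow> real^2^2" where
  "shape_operator g \<Phi> p \<nu> = matrix_inv (first_form g \<Phi> p) ** second_form g \<Phi> p \<nu>"

text \<open>The principal curvatures are the eigenvalues of the shape operator, listed with
  multiplicity.\<close>

definition principal_curvatures ::
    "(real^3 \<Rightarrow> real^3^3) \<Rightarrow> (real^2 \<Rightarrow> real^3) \<Rightarrow> real^2 \<Rightarrow> real^3 \<Rightarrow> real \<Rightarrow> real \<Rightarrow> bool" where
  "principal_curvatures g \<Phi> p \<nu> k1 k2 \<longleftrightarrow>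
     (\<forall>t. det (mat t - shape_operator g \<Phi> p \<nu>) = (t - k1) * (t - k2))"

definition mean_curvature ::
    "(real^3 \<Rightarrow> real^3^3) \<Rightarrow> (real^2 \<Rightarrow> real^3) \<Rightarrow> real^2 \<Rightarrow> real^3 \<Rightarrow> real" where
  "mean_curvature g \<Phi> p \<nu> =
     (THE H. \<exists>k1 k2. principal_curvatures g \<Phi> p \<nu> k1 k2 \<and> H = k1 + k2)"

text \<open>Both sides of \<open>H = g(\<nu>, V)\<close> change sign with \<open>\<nu>\<close>, so the equation is required for
  either unit normal and no orientation has to be chosen.\<close>

definition translator_on ::
    "(real^3 \<Rightarrow> real^3^3) \<Rightarrow> (real^3 \<Rightarrow> real^3) \<Rightarrow> (real^2) set \<Rightarrow> (real^2 \<Rightarrow> real^3) \<Rightarrow> bool" where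
  "translator_on g V D \<Phi> \<longleftrightarrow> immersed_on D \<Phi> \<and>
     (\<forall>p\<in>D. \<forall>\<nu>. unit_normal g \<Phi> p \<nu> \<longrightarrow>
        mean_curvature g \<Phi> p \<nu> = metric_ip g (\<Phi> p) \<nu> (V (\<Phi> p)))"

definition minimal_on ::
    "(real^3 \<Rightarrow> real^3^3) \<Rightarrow> (real^2) set \<Rightarrow> (real^2 \<Rightarrow> real^3) \<Rightarrow> bool" where
  "minimal_on g D \<Phi> \<longleftrightarrow> immersed_on D \<Phi> \<and>
     (\<forall>p\<in>D. \<forall>\<nu>. unit_normal g \<Phi> p \<nu> \<longrightarrow> mean_curvature g \<Phi> p \<nu> = 0)"

text \<open>Invariance under the flow of a complete vector field \<open>X\<close>, expressed by its integral
  curves.\<close>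

definition flow_invariant :: "(real^3 \<Rightarrow> real^3) \<Rightarrow> (real^3) set \<Rightarrow> bool" where
  "flow_invariant X S \<longleftrightarrow>
     (\<forall>c. (\<forall>t. (c has_vector_derivative X (c t)) (at t)) \<and> c 0 \<in> S \<longrightarrow> (\<forall>t. c t \<in> S))"

definition invariant_translator_on ::
    "(real^3 \<Rightarrow> real^3^3) \<Rightarrow> (real^3 \<Rightarrow> real^3) \<Rightarrow> (real^3 \<Rightarrow> real^3) \<Rightarrow>
     (real^2) set \<Rightarrow> (real^2 \<Rightarrow> real^3) \<Rightarrow> bool" where
  "invariant_translator_on g X V D \<Phi> \<longleftrightarrow> flow_invariant X (\<Phi> ` D) \<and> translator_on g V D \<Phi>"


section \<open>The space \<open>Sol\<^sub>3\<close>\<close>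

definition sol_metric :: "real^3 \<Rightarrow> real^3^3" where
  "sol_metric p = vector [vector [exp (2 * p$3), 0, 0],
                          vector [0, exp (- 2 * p$3), 0],
                          vector [0, 0, 1]]"

definition F1 :: "real^3 \<Rightarrow> real^3" where "F1 p = vector [1, 0, 0]"
definition F2 :: "real^3 \<Rightarrow> real^3" where "F2 p = vector [0, 1, 0]"
definition F3 :: "real^3 \<Rightarrow> real^3" where "F3 p = vector [- p$1, p$2, 1]"

definition killing :: "real \<Rightarrow> real \<Rightarrow> real \<Rightarrow> real^3 \<Rightarrow> real^3" where
  "killing a b c p = a *\<^sub>R F1 p + b *\<^sub>R F2 p + c *\<^sub>R F3 p"

definition C2_on :: "real set \<Rightarrow> (real \<Rightarrow> real) \<Rightarrow> bool" where
  "C2_on I f \<longleftrightarrow> (\<forall>s\<in>I. f differentiable (at s) \<and> deriv f differentiable (at s)) \<and>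
     continuous_on I (deriv (deriv f))"

definition plane_curve :: "(real \<Rightarrow> real) \<Rightarrow> (real \<Rightarrow> real) \<Rightarrow> real \<Rightarrow> real^3" where
  "plane_curve x y s = vector [x s, y s, 0]"

definition arclength_curve :: "real set \<Rightarrow> (real \<Rightarrow> real) \<Rightarrow> (real \<Rightarrow> real) \<Rightarrow> bool" where
  "arclength_curve I x y \<longleftrightarrow> C2_on I x \<and> C2_on I y \<and>
     (\<forall>s\<in>I. metric_ip sol_metric (plane_curve x y s)
        (vector_derivative (plane_curve x y) (at s))
        (vector_derivative (plane_curve x y) (at s)) = 1)"

text \<open>The coordinates of the parameter point are \<open>(u, s) = (p$1, p$2)\<close>.\<close>

definition inv_surface ::
    "real \<Rightarrow> real \<Rightarrow> (real \<Rightarrow> real) \<Rightarrow> (real \<Rightarrow> real) \<Rightarrow> real^2 \<Rightarrow> real^3" where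
  "inv_surface a b x y p =
     vector [a * (1 - exp (- (p$1))) + exp (- (p$1)) * x (p$2),
             b * (exp (p$1) - 1) + exp (p$1) * y (p$2),
             p$1]"

definition strip :: "real set \<Rightarrow> (real^2) set" where
  "strip I = {p. p$2 \<in> I}"

end

theory Submission
  imports Defs
begin

text \<open>In the left-invariant orthonormal frame \<open>E\<^sub>1 = e\<^sup>-\<^sup>z \<partial>\<^sub>x\<close>, \<open>E\<^sub>2 = e\<^sup>z \<partial>\<^sub>y\<close>, \<open>E\<^sub>3 = \<partial>\<^sub>z\<close>, the vectors
  \<open>\<Phi>\<^sub>u = X\<close> and \<open>\<Phi>\<^sub>s\<close> have components \<open>(a - x, b + y, 1)\<close> and \<open>(x', y', 0)\<close>, so the mean
  curvature does not depend on \<open>u\<close>. Since \<open>X\<close> is tangent, \<open>g(\<nu>, V)\<close> only sees the part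
  \<open>\<eta>t F\<^sub>1 + lt F\<^sub>2 = \<eta>t e\<^sup>u E\<^sub>1 + lt e\<^sup>-\<^sup>u E\<^sub>2\<close> of \<open>V\<close>, and is proportional to
  \<open>lt x' e\<^sup>-\<^sup>u - \<eta>t y' e\<^sup>u\<close>. Linear independence of \<open>1\<close>, \<open>e\<^sup>u\<close>, \<open>e\<^sup>-\<^sup>u\<close> makes the translator equation
  equivalent to \<open>H = 0\<close> and \<open>lt x' = \<eta>t y' = 0\<close>; and a direct computation gives \<open>H = 0\<close> as soon
  as \<open>x' \<equiv> 0\<close> or \<open>y' \<equiv> 0\<close>.\<close>

section \<open>Derivatives of vector-valued maps and inverse matrices\<close>

lemma partial_eqI:
  assumes "((\<lambda>t. f (p + t *\<^sub>R axis i 1)) has_vector_derivative d) (at 0)"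
  shows "partial i f p = d"
  using assms by (simp add: partial_def vector_derivative_at)

lemma has_vector_derivative_vector_3:
  assumes "(f has_real_derivative f') (at t)" "(g has_real_derivative g') (at t)"
    "(h has_real_derivative h') (at t)"
  shows "((\<lambda>t. vector [f t, g t, h t] :: real^3) has_vector_derivative vector [f', g', h']) (at t)"
proof -
  have vec: "vector [p, q, r] = p *\<^sub>R axis 1 1 + q *\<^sub>R axis 2 1 + r *\<^sub>R (axis 3 1 :: real^3)"
    for p q r :: real
    by (simp add: vec_eq_iff forall_3 axis_def)
  show ?thesis
    unfolding vec using assms by (auto intro!: derivative_eq_intros)
qed

lemma matrix_inv_eqI:
  fixes A :: "'a::semiring_1^'n^'m"
  assumes "A ** B = mat 1" "B ** A = mat 1"
  shows "matrix_inv A = B"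
proof -
  have "A ** matrix_inv A = mat 1 \<and> matrix_inv A ** A = mat 1"
    unfolding matrix_inv_def by (rule someI[of _ B]) (use assms in simp)
  then have "matrix_inv A = matrix_inv A ** (A ** B)" "(matrix_inv A ** A) ** B = B"
    using assms by simp_all
  then show ?thesis by (simp add: matrix_mul_assoc)
qed

section \<open>The metric of Sol_3 and its Christoffel symbols\<close>

lemma metric_ip_sol_metric:
  "metric_ip sol_metric p v w =
     exp (2 * p$3) * v$1 * w$1 + exp (- 2 * p$3) * v$2 * w$2 + v$3 * w$3"
  by (simp add: metric_ip_def sol_metric_def inner_vec_def sum_3 matrix_vector_mult_def)

lemma matrix_inv_sol_metric:
  "matrix_inv (sol_metric p) =
    vector [vector [exp (- 2 * p$3), 0, 0], vector [0, exp (2 * p$3), 0], vector [0, 0, 1]]"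
  by (rule matrix_inv_eqI)
     (simp_all add: sol_metric_def matrix_matrix_mult_def vec_eq_iff forall_3 sum_3 mat_def
        flip: exp_add)

lemma partial_sol_metric:
  "partial i (\<lambda>q. sol_metric q $ j $ l) p =
     (if i = 3 \<and> j = 1 \<and> l = 1 then 2 * exp (2 * p$3)
      else if i = 3 \<and> j = 2 \<and> l = 2 then - 2 * exp (- 2 * p$3) else 0)"
proof -
  have "\<forall>i j l. partial i (\<lambda>q. sol_metric q $ j $ l) p =
     (if i = 3 \<and> j = 1 \<and> l = 1 then 2 * exp (2 * p$3)
      else if i = 3 \<and> j = 2 \<and> l = 2 then - 2 * exp (- 2 * p$3) else 0)"
    unfolding forall_3
    by (intro conjI; rule partial_eqI)
       (auto simp: sol_metric_def axis_def  intro!: derivative_eq_intros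
         simp flip: has_real_derivative_iff_has_vector_derivative)
  then show ?thesis by blast
qed

lemma christoffel_sol_metric:
  "christoffel sol_metric p k i j =
     (if k = 1 \<and> (i = 1 \<and> j = 3 \<or> i = 3 \<and> j = 1) then 1
      else if k = 2 \<and> (i = 2 \<and> j = 3 \<or> i = 3 \<and> j = 2) then - 1
      else if k = 3 \<and> i = 1 \<and> j = 1 then - exp (2 * p$3)
      else if k = 3 \<and> i = 2 \<and> j = 2 then exp (- 2 * p$3) else 0)"
proof -
  have "\<forall>k i j. christoffel sol_metric p k i j =
     (if k = 1 \<and> (i = 1 \<and> j = 3 \<or> i = 3 \<and> j = 1) then 1
      else if k = 2 \<and> (i = 2 \<and> j = 3 \<or> i = 3 \<and> j = 2) then - 1
      else if k = 3 \<and> i = 1 \<and> j = 1 then - exp (2 * p$3)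
      else if k = 3 \<and> i = 2 \<and> j = 2 then exp (- 2 * p$3) else 0)"
    unfolding forall_3 christoffel_def
    by (simp add: matrix_inv_sol_metric partial_sol_metric sum_3 flip: exp_add)
  then show ?thesis by blast
qed

section \<open>Mean curvature in terms of the two fundamental forms\<close>

text \<open>Since \<open>mean_curvature\<close> is a definite description over pairs of real roots,
  the trace formula alone is not enough: the characteristic polynomial must split over the reals,
  and the sum of its roots must be unique.\<close>

lemma mean_curvature_eq:
  assumes I: "first_form g \<Phi> p = vector [vector [E, F], vector [F, G]]"
    and II: "second_form g \<Phi> p \<nu> = vector [vector [e, f], vector [f, h]]"
    and pos: "G > 0" "E * G - F\<^sup>2 > 0"
  shows "mean_curvature g \<Phi> p \<nu> = (e * G - 2 * f * F + h * E) / (E * G - F\<^sup>2)"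
proof -
  define \<Delta> where "\<Delta> = E * G - F\<^sup>2"
  have \<Delta>: "\<Delta> > 0" using pos by (simp add: \<Delta>_def)
  have inv: "matrix_inv (first_form g \<Phi> p) =
      vector [vector [G / \<Delta>, - F / \<Delta>], vector [- F / \<Delta>, E / \<Delta>]]"
    unfolding I using \<Delta>
    by (intro matrix_inv_eqI)
       (simp_all add: matrix_matrix_mult_def vec_eq_iff forall_2 sum_2 mat_def field_simps,
         simp_all add: \<Delta>_def power2_eq_square)
  define T where "T = (e * G - 2 * f * F + h * E) / \<Delta>"
  define K where "K = (e * h - f\<^sup>2) / \<Delta>"
  have char: "det (mat t - shape_operator g \<Phi> p \<nu>) = t\<^sup>2 - T * t + K" for t
  proof -
    have "(G * E - F\<^sup>2) * (e * h - f\<^sup>2) / \<Delta>\<^sup>2 = K"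
      using \<Delta> by (simp add: K_def power2_eq_square mult.commute[of G] flip: \<Delta>_def[unfolded power2_eq_square])
    moreover have "det (mat t - shape_operator g \<Phi> p \<nu>) =
        t\<^sup>2 - T * t + (G * E - F\<^sup>2) * (e * h - f\<^sup>2) / \<Delta>\<^sup>2"
      unfolding shape_operator_def inv II T_def using \<Delta>
      by (simp add: det_2 matrix_matrix_mult_def sum_2 mat_def field_simps power2_eq_square)
    ultimately show ?thesis by simp
  qed
  \<comment> \<open>Self-adjointness of the shape operator: in a basis orthogonal for the first form, the
    discriminant of its characteristic polynomial is a sum of squares.\<close>
  have disc: "T\<^sup>2 - 4 * K \<ge> 0"
  proof -
    \<comment> \<open>This is the second form on \<open>G\<close> times the first tangent vector
      minus \<open>F\<close> times the second one, a vector orthogonal to the second tangent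
      vector.\<close>
    define e' where "e' = G\<^sup>2 * e - 2 * f * F * G + h * F\<^sup>2"
    have "(G * \<Delta>)\<^sup>2 * (T\<^sup>2 - 4 * K) =
        (G * (e * G - 2 * f * F + h * E))\<^sup>2 - 4 * \<Delta> * G\<^sup>2 * (e * h - f\<^sup>2)"
      using \<Delta> by (simp add: T_def K_def power2_eq_square field_simps)
    also have "\<dots> = (e' - h * \<Delta>)\<^sup>2 + 4 * \<Delta> * (G * f - h * F)\<^sup>2"
      unfolding e'_def \<Delta>_def by algebra
    also have "\<dots> \<ge> 0" using \<Delta> by simp
    finally show ?thesis using \<Delta> pos by (simp add: zero_le_mult_iff)
  qed
  have "mean_curvature g \<Phi> p \<nu> = T"
    unfolding mean_curvature_def
  proof (rule the_equality)
    define r where "r = sqrt (T\<^sup>2 - 4 * K)"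
    have "r\<^sup>2 = T\<^sup>2 - 4 * K" using disc by (simp add: r_def)
    then have "t\<^sup>2 - T * t + K = (t - (T + r) / 2) * (t - (T - r) / 2)" for t
      by (simp add: field_simps power2_eq_square)
    then have "principal_curvatures g \<Phi> p \<nu> ((T + r) / 2) ((T - r) / 2)"
      by (simp add: principal_curvatures_def char)
    moreover have "T = (T + r) / 2 + (T - r) / 2" by (simp add: field_simps)
    ultimately show "\<exists>k1 k2. principal_curvatures g \<Phi> p \<nu> k1 k2 \<and> T = k1 + k2" by blast
  next
    fix H assume "\<exists>k1 k2. principal_curvatures g \<Phi> p \<nu> k1 k2 \<and> H = k1 + k2"
    then obtain k1 k2 where k: "\<And>t. t\<^sup>2 - T * t + K = (t - k1) * (t - k2)" and H: "H = k1 + k2"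
      by (auto simp: principal_curvatures_def char)
    \<comment> \<open>The value at 0 gives \<open>K = k1 * k2\<close>; subtracting this from the
      value at 1 leaves \<open>T = k1 + k2\<close>.\<close>
    from k[of 0] k[of 1] H show "H = T" by (simp add: algebra_simps)
  qed
  then show ?thesis by (simp add: T_def \<Delta>_def)
qed


text \<open>At 0, \<open>ln 2\<close> and \<open>- ln 2\<close> the exponentials are rational, and
  these three equations already form a nonsingular linear system.\<close>

lemma exp_combination_const:
  fixes c \<alpha> \<beta> :: real
  assumes "\<And>u. c = \<alpha> * exp u + \<beta> * exp (- u)"
  shows "\<alpha> = 0" "\<beta> = 0" "c = 0"
  using assms[of 0] assms[of "ln 2"] assms[of "- ln 2"] by (simp_all add: exp_minus)

text \<open>The metric is Euclidean on the plane z = 0, where the curve lies.\<close>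

lemma arclength_curve_iff:
  "arclength_curve I x y \<longleftrightarrow>
     C2_on I x \<and> C2_on I y \<and> (\<forall>s\<in>I. (deriv x s)\<^sup>2 + (deriv y s)\<^sup>2 = 1)"
proof -
  have "vector_derivative (plane_curve x y) (at s) = vector [deriv x s, deriv y s, 0]"
    if "x differentiable at s" "y differentiable at s" for s
  proof (rule vector_derivative_at)
    show "(plane_curve x y has_vector_derivative vector [deriv x s, deriv y s, 0]) (at s)"
      unfolding plane_curve_def using that
      by (intro has_vector_derivative_vector_3 DERIV_const)
         (auto simp: DERIV_deriv_iff_real_differentiable)
  qed
  then show ?thesis
    by (auto simp: arclength_curve_def C2_on_def metric_ip_sol_metric plane_curve_def
        simp flip: power2_eq_square)
qed

section \<open>Invariance under the flow of X\<close>

text \<open>Along an integral curve the three quantities e^t (x - a), e^(-t) (y + b) and z - t are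
  constant. This determines the curve, and following it for time t amounts to replacing u by u + t,
  which stays in the strip.\<close>

lemma flow_invariant_inv_surface:
  "flow_invariant (killing a b 1) (inv_surface a b x y ` strip I)"
  unfolding flow_invariant_def
proof (intro allI impI, elim conjE)
  fix c :: "real \<Rightarrow> real^3" and t :: real
  assume c: "\<forall>t. (c has_vector_derivative killing a b 1 (c t)) (at t)"
    and "c 0 \<in> inv_surface a b x y ` strip I"
  then obtain p where p: "p \<in> strip I" "c 0 = inv_surface a b x y p" by auto
  have comp: "((\<lambda>t. c t $ i) has_real_derivative killing a b 1 (c t) $ i) (at t)" for i t
    using bounded_linear.has_vector_derivative[OF bounded_linear_vec_nth, of c] c
    by (simp add: has_real_derivative_iff_has_vector_derivative)
  have const: "f t = f 0" if "\<And>t. (f has_real_derivative 0) (at t)" for f :: "real \<Rightarrow> real"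
    using DERIV_isconst_all[of f] that by blast
  have kill: "killing a b 1 q = vector [a - q$1, b + q$2, 1]" for q
    by (simp add: killing_def F1_def F2_def F3_def vec_eq_iff forall_3)
  note [derivative_intros] = comp[of 1, unfolded kill vector_3] comp[of 2, unfolded kill vector_3]
    comp[of 3, unfolded kill vector_3]
  have 1: "exp t * (c t $ 1 - a) = exp 0 * (c 0 $ 1 - a)"
    by (rule const) (auto intro!: derivative_eq_intros simp: algebra_simps)
  have 2: "exp (- t) * (c t $ 2 + b) = exp (- 0) * (c 0 $ 2 + b)"
    by (rule const) (auto intro!: derivative_eq_intros simp: algebra_simps)
  have 3: "c t $ 3 - t = c 0 $ 3 - 0"
    by (rule const) (auto intro!: derivative_eq_intros)
  have "c t $ 1 = a + exp (- t) * (c 0 $ 1 - a)" "c t $ 2 = - b + exp t * (c 0 $ 2 + b)"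
    using 1 2 by (simp_all add: exp_minus field_simps)
  with 3 have "c t = inv_surface a b x y (vector [p$1 + t, p$2])"
    unfolding p(2) inv_surface_def
    by (simp add: vec_eq_iff forall_3 exp_add algebra_simps exp_diff exp_minus divide_inverse)
  moreover have "vector [p$1 + t, p$2] \<in> strip I"
    using p(1) by (simp add: strip_def)
  ultimately show "c t \<in> inv_surface a b x y ` strip I" by blast
qed

section \<open>Tangent vectors and second derivatives of an invariant surface\<close>

locale sol_invariant_surface =
  fixes a b :: real and x y :: "real \<Rightarrow> real" and I :: "real set"
  assumes open_I: "open I" and arclength: "arclength_curve I x y"
begin

abbreviation \<Phi> where "\<Phi> \<equiv> inv_surface a b x y"

lemma derivs:
  assumes "s \<in> I"
  shows "(x has_real_derivative deriv x s) (at s)" "(y has_real_derivative deriv y s) (at s)"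
    "(deriv x has_real_derivative deriv (deriv x) s) (at s)"
    "(deriv y has_real_derivative deriv (deriv y) s) (at s)"
  using arclength assms
  by (auto simp: arclength_curve_def C2_on_def DERIV_deriv_iff_real_differentiable)

lemma unit_speed: "s \<in> I \<Longrightarrow> (deriv x s)\<^sup>2 + (deriv y s)\<^sup>2 = 1"
  using arclength by (simp add: arclength_curve_iff)

lemma partial_1:
  "partial 1 \<Phi> p = vector [exp (- p$1) * (a - x (p$2)), exp (p$1) * (b + y (p$2)), 1]"
  unfolding inv_surface_def
  by (intro partial_eqI has_vector_derivative_vector_3)
     (auto simp: axis_def algebra_simps intro!: derivative_eq_intros)

lemma shifted_derivs:
  assumes "p$2 \<in> I"
  shows "((\<lambda>t. x (p$2 + t)) has_real_derivative deriv x (p$2)) (at 0)"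
    "((\<lambda>t. y (p$2 + t)) has_real_derivative deriv y (p$2)) (at 0)"
    "((\<lambda>t. deriv x (p$2 + t)) has_real_derivative deriv (deriv x) (p$2)) (at 0)"
    "((\<lambda>t. deriv y (p$2 + t)) has_real_derivative deriv (deriv y) (p$2)) (at 0)"
  using derivs[OF assms] DERIV_shift[of _ _ 0 "p$2"] by (simp_all add: add.commute[of _ "p$2"])

lemma partial_2:
  assumes "p$2 \<in> I"
  shows "partial 2 \<Phi> p = vector [exp (- p$1) * deriv x (p$2), exp (p$1) * deriv y (p$2), 0]"
  unfolding inv_surface_def
  by (intro partial_eqI has_vector_derivative_vector_3)
     (auto simp: axis_def intro!: derivative_eq_intros shifted_derivs assms)

lemma partial_11:
  "partial 1 (partial 1 \<Phi>) p =
     vector [- exp (- p$1) * (a - x (p$2)), exp (p$1) * (b + y (p$2)), 0]"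
  unfolding partial_1
  by (intro partial_eqI has_vector_derivative_vector_3)
     (auto simp: axis_def algebra_simps intro!: derivative_eq_intros)

lemma partial_21:
  assumes "p$2 \<in> I"
  shows "partial 2 (partial 1 \<Phi>) p =
     vector [- exp (- p$1) * deriv x (p$2), exp (p$1) * deriv y (p$2), 0]"
  unfolding partial_1
  by (intro partial_eqI has_vector_derivative_vector_3)
     (auto simp: axis_def intro!: derivative_eq_intros shifted_derivs assms)

lemma partial_12:
  assumes "p$2 \<in> I"
  shows "partial 1 (partial 2 \<Phi>) p =
     vector [- exp (- p$1) * deriv x (p$2), exp (p$1) * deriv y (p$2), 0]"
proof (rule partial_eqI)
  have "(p + t *\<^sub>R axis 1 1) $ 2 = p $ 2" for t by (simp add: axis_def)
  then show "((\<lambda>t. partial 2 \<Phi> (p + t *\<^sub>R axis 1 1)) has_vector_derivative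
      vector [- exp (- p$1) * deriv x (p$2), exp (p$1) * deriv y (p$2), 0]) (at 0)"
    using assms by (simp add: partial_2 del: vector_add_component)
     (intro has_vector_derivative_vector_3;
       auto simp: axis_def algebra_simps intro!: derivative_eq_intros)
qed

text \<open>The formula for \<open>partial 2\<close> is available only while the second coordinate
  stays in \<open>I\<close>. The explicit formula is therefore differentiated first, and the result
  is transferred through the open set \<open>?S\<close> of admissible increments.\<close>

lemma partial_22:
  assumes "p$2 \<in> I"
  shows "partial 2 (partial 2 \<Phi>) p =
     vector [exp (- p$1) * deriv (deriv x) (p$2), exp (p$1) * deriv (deriv y) (p$2), 0]"
proof (rule partial_eqI)
  let ?S = "(\<lambda>t. p$2 + t) -` I"
  have open_S: "open ?S" by (intro open_vimage open_I continuous_intros)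
  have "((\<lambda>t. vector [exp (- p$1) * deriv x (p$2 + t), exp (p$1) * deriv y (p$2 + t), 0] :: real^3)
      has_vector_derivative
      vector [exp (- p$1) * deriv (deriv x) (p$2), exp (p$1) * deriv (deriv y) (p$2), 0]) (at 0)"
    by (intro has_vector_derivative_vector_3)
       (auto intro!: derivative_eq_intros shifted_derivs assms)
  then show "((\<lambda>t. partial 2 \<Phi> (p + t *\<^sub>R axis 2 1)) has_vector_derivative
      vector [exp (- p$1) * deriv (deriv x) (p$2), exp (p$1) * deriv (deriv y) (p$2), 0]) (at 0)"
    by (rule has_vector_derivative_transform_within_open[OF _ open_S])
       (use assms in \<open>auto simp: partial_2 axis_def\<close>)
qed

text \<open>The third coordinate forces \<open>c = 0\<close>; unit speed then forces
  \<open>d = 0\<close>.\<close>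

lemma immersed: "immersed_on (strip I) \<Phi>"
  unfolding immersed_on_def
proof (intro ballI allI impI)
  fix p c d assume "p \<in> strip I" and *: "c *\<^sub>R partial 1 \<Phi> p + d *\<^sub>R partial 2 \<Phi> p = 0"
  then have p: "p$2 \<in> I" by (simp add: strip_def)
  from * show "c = 0 \<and> d = 0"
    using unit_speed[OF p] by (auto simp: vec_eq_iff forall_3 partial_1 partial_2[OF p])
qed

text \<open>In the frame \<open>E\<^sub>1, E\<^sub>2, E\<^sub>3\<close> the cross product \<open>\<Phi>\<^sub>u \<times> \<Phi>\<^sub>s\<close> is \<open>(- y', x', D)\<close>, and \<open>A\<close> is
  \<open>e G - 2 f F + g E\<close> for the second form \<open>(e, f, g)\<close> taken with respect to this normal; the
  first form is \<open>E = P\<^sup>2 + Q\<^sup>2 + 1\<close>, \<open>F = P x' + Q y'\<close>, \<open>G = 1\<close>.\<close>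

definition D :: "real \<Rightarrow> real" where
  "D s = (a - x s) * deriv y s - (b + y s) * deriv x s"

definition A :: "real \<Rightarrow> real" where
  "A s = (let P = a - x s; Q = b + y s; x' = deriv x s; y' = deriv y s in
     (- P * y' - Q * x' + D s * (Q\<^sup>2 - P\<^sup>2))
     - 2 * (D s * (Q * y' - P * x')) * (P * x' + Q * y')
     + (x' * deriv (deriv y) s - deriv (deriv x) s * y' + D s * (y'\<^sup>2 - x'\<^sup>2)) * (P\<^sup>2 + Q\<^sup>2 + 1))"

text \<open>The cross product above, written in the coordinate frame. Over \<open>I\<close> its
  squared length is 1 + D^2, by unit speed.\<close>

definition normal_field :: "real^2 \<Rightarrow> real^3" where
  "normal_field p = vector [- exp (- p$1) * deriv y (p$2), exp (p$1) * deriv x (p$2), D (p$2)]"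

section \<open>Unit normals and mean curvature of an invariant surface\<close>

text \<open>Orthogonality to the s-direction makes the first two frame components a multiple of (-
  y', x'), orthogonality to the u-direction then determines the third, and the length fixes the
  factor up to sign.\<close>

lemma unit_normal_iff:
  assumes p: "p$2 \<in> I"
  shows "unit_normal sol_metric \<Phi> p \<nu> \<longleftrightarrow>
    (\<exists>k. k\<^sup>2 * (1 + (D (p$2))\<^sup>2) = 1 \<and>
      \<nu> = k *\<^sub>R normal_field p)"
    (is "?L \<longleftrightarrow> ?R")
proof -
  define P Q x' y' where d: "P = a - x (p$2)" "Q = b + y (p$2)"
    "x' = deriv x (p$2)" "y' = deriv y (p$2)"
  define E where "E = exp (p$1)"
  have Epos: "E > 0" by (simp add: E_def)
  have E: "exp (- p$1) = 1 / E" "exp (2 * p$1) = E\<^sup>2" "exp (- (2 * p$1)) = 1 / E\<^sup>2"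
    by (simp_all add: E_def exp_minus exp_double divide_inverse)
  have sp: "x'\<^sup>2 + y'\<^sup>2 = 1" using unit_speed[OF p] by (simp add: d)
  have Ph: "\<Phi> p $ 3 = p $ 1" by (simp add: inv_surface_def)
  have D: "D (p$2) = P * y' - Q * x'" by (simp add: D_def d)
  \<comment> \<open>Components of the normal in the orthonormal frame; in terms of them all
    exponentials drop out of the conditions.\<close>
  define n1 n2 where n: "n1 = E * \<nu>$1" "n2 = \<nu>$2 / E"
  have \<nu>: "\<nu>$1 = n1 / E" "\<nu>$2 = E * n2" using Epos by (simp_all add: n)
  have L: "?L \<longleftrightarrow> n1\<^sup>2 + n2\<^sup>2 + (\<nu>$3)\<^sup>2 = 1 \<and> n1 * P + n2 * Q + \<nu>$3 = 0 \<and> n1 * x' + n2 * y' = 0"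
    unfolding unit_normal_def metric_ip_sol_metric forall_2 partial_1 partial_2[OF p] Ph
    using Epos by (simp add: E \<nu> flip: d E_def) (simp add: power2_eq_square field_simps)
  have R: "?R \<longleftrightarrow> (\<exists>k. k\<^sup>2 * (1 + (P * y' - Q * x')\<^sup>2) = 1 \<and> n1 = - k * y' \<and> n2 = k * x' \<and>
      \<nu>$3 = k * (P * y' - Q * x'))"
    unfolding vec_eq_iff forall_3 normal_field_def D
    using Epos by (simp add: E \<nu> flip: d E_def) (simp add: field_simps)
  show ?thesis
    unfolding L R
  proof (intro iffI)
    assume *: "n1\<^sup>2 + n2\<^sup>2 + (\<nu>$3)\<^sup>2 = 1 \<and> n1 * P + n2 * Q + \<nu>$3 = 0 \<and> n1 * x' + n2 * y' = 0"
    \<comment> \<open>The inner product of (n1, n2) with the unit vector (- y', x').\<close>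
    define k where "k = x' * n2 - y' * n1"
    have n1: "n1 = - k * y'" and n2: "n2 = k * x'"
      using * sp unfolding k_def by algebra+
    have n3: "\<nu>$3 = k * (P * y' - Q * x')" using * n1 n2 by algebra
    have "k\<^sup>2 * (1 + (P * y' - Q * x')\<^sup>2) = 1"
      using *[THEN conjunct1] sp unfolding n1 n2 n3 by algebra
    with n1 n2 n3 show "\<exists>k. k\<^sup>2 * (1 + (P * y' - Q * x')\<^sup>2) = 1 \<and> n1 = - k * y' \<and> n2 = k * x' \<and>
      \<nu>$3 = k * (P * y' - Q * x')" by blast
  next
    assume "\<exists>k. k\<^sup>2 * (1 + (P * y' - Q * x')\<^sup>2) = 1 \<and> n1 = - k * y' \<and> n2 = k * x' \<and>
      \<nu>$3 = k * (P * y' - Q * x')"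
    then obtain k where k: "k\<^sup>2 * (1 + (P * y' - Q * x')\<^sup>2) = 1" "n1 = - k * y'" "n2 = k * x'"
      "\<nu>$3 = k * (P * y' - Q * x')" by blast
    show "n1\<^sup>2 + n2\<^sup>2 + (\<nu>$3)\<^sup>2 = 1 \<and> n1 * P + n2 * Q + \<nu>$3 = 0 \<and> n1 * x' + n2 * y' = 0"
    proof (intro conjI)
      show "n1\<^sup>2 + n2\<^sup>2 + (\<nu>$3)\<^sup>2 = 1"
        using k(1) sp unfolding k(2-4) by algebra
    qed (simp_all add: k(2-4) algebra_simps)
  qed
qed

text \<open>Keeping \<open>k\<close> free treats both unit normals at once. The value is linear in
  \<open>k\<close> because the second form is linear in the normal.\<close>

lemma mean_curvature_normal:
  assumes p: "p$2 \<in> I"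
  shows "mean_curvature sol_metric \<Phi> p (k *\<^sub>R normal_field p) = k * A (p$2) / (1 + (D (p$2))\<^sup>2)"
proof -
  define P Q x' y' x'' y'' where d: "P = a - x (p$2)" "Q = b + y (p$2)"
    "x' = deriv x (p$2)" "y' = deriv y (p$2)"
    "x'' = deriv (deriv x) (p$2)" "y'' = deriv (deriv y) (p$2)"
  define E where "E = exp (p$1)"
  have Epos: "E > 0" by (simp add: E_def)
  have E: "exp (- p$1) = 1 / E" "exp (2 * p$1) = E\<^sup>2" "exp (- (2 * p$1)) = 1 / E\<^sup>2"
    by (simp_all add: E_def exp_minus exp_double divide_inverse)
  have sp: "x'\<^sup>2 + y'\<^sup>2 = 1" using unit_speed[OF p] by (simp add: d)
  have Ph: "\<Phi> p $ 3 = p $ 1" by (simp add: inv_surface_def)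
  note pars = partial_1[of p] partial_2[OF p] partial_11[of p] partial_12[OF p] partial_21[OF p] partial_22[OF p]
  note pd = pars[folded d E_def, unfolded E(1)]
  note gd = metric_ip_sol_metric[of "\<Phi> p", unfolded Ph, simplified, unfolded E(2,3)]
  define D' where "D' = D (p$2)"
  have D: "D' = P * y' - Q * x'" by (simp add: D'_def D_def d)
  have I: "first_form sol_metric \<Phi> p =
      vector [vector [P\<^sup>2 + Q\<^sup>2 + 1, P * x' + Q * y'], vector [P * x' + Q * y', 1]]"
    unfolding first_form_def vec_eq_iff forall_2
    using Epos sp by (simp add: gd pd) (simp add: power2_eq_square field_simps)
  have cov:
     "cov_deriv sol_metric \<Phi> p 1 1 = vector [P / E, - (E * Q), Q\<^sup>2 - P\<^sup>2]"
     "cov_deriv sol_metric \<Phi> p 1 2 = vector [0, 0, Q * y' - P * x']"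
     "cov_deriv sol_metric \<Phi> p 2 1 = vector [0, 0, Q * y' - P * x']"
     "cov_deriv sol_metric \<Phi> p 2 2 = vector [x'' / E, E * y'', y'\<^sup>2 - x'\<^sup>2]"
    unfolding cov_deriv_def christoffel_sol_metric vec_eq_iff forall_3 sum_3
    using Epos by (simp_all add: pd Ph E) (simp_all add: power2_eq_square field_simps)
  have II: "second_form sol_metric \<Phi> p (k *\<^sub>R normal_field p) =
      vector [vector [k * (- P * y' - Q * x' + D' * (Q\<^sup>2 - P\<^sup>2)), k * (D' * (Q * y' - P * x'))],
        vector [k * (D' * (Q * y' - P * x')), k * (x' * y'' - x'' * y' + D' * (y'\<^sup>2 - x'\<^sup>2))]]"
    unfolding second_form_def vec_eq_iff forall_2 normal_field_def
    using Epos by (simp add: gd cov E flip: d E_def D'_def) (simp add: power2_eq_square field_simps)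
  \<comment> \<open>Lagrange's identity: the Gram determinant of the two tangent vectors is the
    squared length of their cross product.\<close>
  have \<Delta>: "(P\<^sup>2 + Q\<^sup>2 + 1) * 1 - (P * x' + Q * y')\<^sup>2 = 1 + D'\<^sup>2"
    using sp unfolding D by algebra
  have "mean_curvature sol_metric \<Phi> p (k *\<^sub>R normal_field p) =
    (k * (- P * y' - Q * x' + D' * (Q\<^sup>2 - P\<^sup>2)) * 1
      - 2 * (k * (D' * (Q * y' - P * x'))) * (P * x' + Q * y')
      + k * (x' * y'' - x'' * y' + D' * (y'\<^sup>2 - x'\<^sup>2)) * (P\<^sup>2 + Q\<^sup>2 + 1)) / (1 + D'\<^sup>2)"
    using mean_curvature_eq[OF I II, unfolded \<Delta>] by (simp add: add_pos_nonneg)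
  also have "\<dots> = k * A (p$2) / (1 + D'\<^sup>2)"
    unfolding A_def Let_def d[symmetric] D'_def[symmetric] by (simp add: algebra_simps)
  finally show ?thesis by (simp add: D'_def)
qed

lemma killing_normal:
  assumes p: "p$2 \<in> I"
  shows "metric_ip sol_metric (\<Phi> p) (k *\<^sub>R normal_field p) (killing \<eta> l \<mu> (\<Phi> p)) =
    k * (- (\<eta> - \<mu> * a) * deriv y (p$2) * exp (p$1) + (l - \<mu> * b) * deriv x (p$2) * exp (- p$1))"
proof -
  define E where "E = exp (p$1)"
  have Epos: "E > 0" by (simp add: E_def)
  have E: "exp (- p$1) = 1 / E" "exp (2 * p$1) = E\<^sup>2" "exp (- (2 * p$1)) = 1 / E\<^sup>2"
    by (simp_all add: E_def exp_minus exp_double divide_inverse)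
  show ?thesis
    using Epos
    by (simp add: normal_field_def metric_ip_sol_metric killing_def F1_def F2_def F3_def
        inv_surface_def D_def E flip: E_def)
       (simp add: power2_eq_square field_simps)
qed

text \<open>Guarantees that a quantification over all unit normals is not vacuous.\<close>

lemma normal_exists:
  "\<exists>k. k\<^sup>2 * (1 + (D s)\<^sup>2) = 1 \<and> k \<noteq> 0"
proof (intro exI[of _ "1 / sqrt (1 + (D s)\<^sup>2)"] conjI)
  have pos: "1 + (D s)\<^sup>2 > 0" by (simp add: add_pos_nonneg)
  then show "(1 / sqrt (1 + (D s)\<^sup>2))\<^sup>2 * (1 + (D s)\<^sup>2) = 1" by (simp add: power_divide)
  show "1 / sqrt (1 + (D s)\<^sup>2) \<noteq> 0" using pos by simp
qed

text \<open>Both sides are linear in the factor \<open>k\<close>, so cancelling a nonzero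
  \<open>k\<close> leaves one scalar equation. It is applied with \<open>f\<close> zero for
  minimality and with \<open>f\<close> the inner product with V for translators.\<close>

lemma prescribed_mean_curvature_iff:
  assumes p: "p$2 \<in> I"
    and f: "\<And>k. f (k *\<^sub>R normal_field p) = k * c"
  shows "(\<forall>\<nu>. unit_normal sol_metric \<Phi> p \<nu> \<longrightarrow> mean_curvature sol_metric \<Phi> p \<nu> = f \<nu>) \<longleftrightarrow>
    A (p$2) / (1 + (D (p$2))\<^sup>2) = c"
proof
  assume *: "\<forall>\<nu>. unit_normal sol_metric \<Phi> p \<nu> \<longrightarrow> mean_curvature sol_metric \<Phi> p \<nu> = f \<nu>"
  obtain k where k: "k\<^sup>2 * (1 + (D (p$2))\<^sup>2) = 1" "k \<noteq> 0" using normal_exists by blast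
  with * show "A (p$2) / (1 + (D (p$2))\<^sup>2) = c"
    using mean_curvature_normal[OF p, of k] f[of k] unit_normal_iff[OF p]
    by (metis mult_cancel_left times_divide_eq_right)
next
  assume *: "A (p$2) / (1 + (D (p$2))\<^sup>2) = c"
  show "\<forall>\<nu>. unit_normal sol_metric \<Phi> p \<nu> \<longrightarrow> mean_curvature sol_metric \<Phi> p \<nu> = f \<nu>"
    unfolding unit_normal_iff[OF p] using f mean_curvature_normal[OF p] * by auto
qed

section \<open>Scalar equations for minimal surfaces and translators\<close>

lemma minimal_iff: "minimal_on sol_metric (strip I) \<Phi> \<longleftrightarrow> (\<forall>s\<in>I. A s = 0)"
proof -
  have "1 + (D s)\<^sup>2 \<noteq> 0" for s using zero_le_power2[of "D s"] by linarith
  then have "(\<forall>\<nu>. unit_normal sol_metric \<Phi> p \<nu> \<longrightarrow> mean_curvature sol_metric \<Phi> p \<nu> = 0) \<longleftrightarrow> A (p$2) = 0"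
    if "p$2 \<in> I" for p
    using prescribed_mean_curvature_iff[OF that, of "\<lambda>_. 0" 0] by auto
  then show ?thesis
    unfolding minimal_on_def strip_def using immersed
    \<comment> \<open>Each parameter in \<open>I\<close> is reached by the strip point over it with
      u = 0.\<close>
    by (auto simp: strip_def dest: spec[of _ "vector [0, _]"])
qed

lemma translator_iff:
  "translator_on sol_metric (killing \<eta> l \<mu>) (strip I) \<Phi> \<longleftrightarrow>
     minimal_on sol_metric (strip I) \<Phi> \<and>
     (\<forall>s\<in>I. (l - \<mu> * b) * deriv x s = 0 \<and> (\<eta> - \<mu> * a) * deriv y s = 0)"
proof -
  let ?eq = "\<lambda>u s. A s / (1 + (D s)\<^sup>2) =
    - (\<eta> - \<mu> * a) * deriv y s * exp u + (l - \<mu> * b) * deriv x s * exp (- u)"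
  have "translator_on sol_metric (killing \<eta> l \<mu>) (strip I) \<Phi> \<longleftrightarrow> (\<forall>p\<in>strip I. ?eq (p$1) (p$2))"
    unfolding translator_on_def using immersed
      prescribed_mean_curvature_iff[OF _ killing_normal] by (auto simp: strip_def)
  \<comment> \<open>Over each s the strip contains the entire u-line, so the equation holds for all
    real u with s fixed.\<close>
  also have "\<dots> \<longleftrightarrow> (\<forall>s\<in>I. \<forall>u. ?eq u s)"
    by (auto simp: strip_def dest: spec[of _ "vector [_, _]"])
  also have "\<dots> \<longleftrightarrow> (\<forall>s\<in>I. A s = 0 \<and> (l - \<mu> * b) * deriv x s = 0 \<and> (\<eta> - \<mu> * a) * deriv y s = 0)"
  proof (intro ball_cong refl iffI)
    fix s assume *: "\<forall>u. ?eq u s"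
    have "1 + (D s)\<^sup>2 \<noteq> 0" using zero_le_power2[of "D s"] by linarith
    with exp_combination_const[OF *[rule_format]]
    show "A s = 0 \<and> (l - \<mu> * b) * deriv x s = 0 \<and> (\<eta> - \<mu> * a) * deriv y s = 0" by auto
  qed auto
  finally show ?thesis by (auto simp: minimal_iff)
qed

lemma invariant_translator_iff:
  "invariant_translator_on sol_metric (killing a b 1) (killing \<eta> l \<mu>) (strip I) \<Phi> \<longleftrightarrow>
     minimal_on sol_metric (strip I) \<Phi> \<and>
     (\<forall>s\<in>I. (l - \<mu> * b) * deriv x s = 0 \<and> (\<eta> - \<mu> * a) * deriv y s = 0)"
  by (simp add: invariant_translator_on_def flow_invariant_inv_surface translator_iff)

lemma deriv_zero_imp_deriv2_zero:
  assumes "\<And>s. s \<in> I \<Longrightarrow> deriv f s = 0" "s \<in> I"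
  shows "deriv (deriv f) s = 0"
proof -
  have "(deriv f has_real_derivative 0) (at s)"
    by (rule has_field_derivative_transform_within_open[OF DERIV_const open_I assms(2)])
       (use assms(1) in auto)
  then show ?thesis by (rule DERIV_imp_deriv)
qed

text \<open>Vanishing on all of the open set \<open>I\<close> makes the second derivative vanish
  too. Writing P = a - x and Q = b + y, if x' = 0 then y'^2 = 1 and D = P y', and \<open>A\<close>
  collapses to D - P y' = 0. If y' = 0 then D = - Q x', and \<open>A\<close> collapses to - Q x' - D
  = 0.\<close>

lemma minimal_if_horizontal_or_vertical:
  assumes "(\<forall>s\<in>I. deriv x s = 0) \<or> (\<forall>s\<in>I. deriv y s = 0)"
  shows "minimal_on sol_metric (strip I) \<Phi>"
  unfolding minimal_iff
proof
  fix s assume s: "s \<in> I"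
  note sp = unit_speed[OF s]
  from assms show "A s = 0"
  proof
    assume *: "\<forall>s\<in>I. deriv x s = 0"
    then have "deriv x s = 0" "deriv (deriv x) s = 0"
      using s deriv_zero_imp_deriv2_zero by auto
    with sp show ?thesis
      unfolding A_def D_def Let_def by simp algebra
  next
    assume *: "\<forall>s\<in>I. deriv y s = 0"
    then have "deriv y s = 0" "deriv (deriv y) s = 0"
      using s deriv_zero_imp_deriv2_zero by auto
    with sp show ?thesis
      unfolding A_def D_def Let_def by simp algebra
  qed
qed

end

section \<open>Curves with a constant coordinate and the surfaces they sweep out\<close>

lemma deriv_zero_imp_constant:
  assumes "is_interval I" "C2_on I f" "\<And>s. s \<in> I \<Longrightarrow> deriv f s = 0"
  shows "\<exists>c. \<forall>s\<in>I. f s = c"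
proof (rule has_field_derivative_zero_constant)
  show "convex I" using assms(1) by (simp add: is_interval_convex_1)
  show "(f has_field_derivative 0) (at s within I)" if "s \<in> I" for s
  proof (rule has_field_derivative_at_within)
    have "(f has_field_derivative deriv f s) (at s)"
      using assms(2) that by (auto simp: C2_on_def DERIV_deriv_iff_real_differentiable)
    then show "(f has_field_derivative 0) (at s)" using assms(3)[OF that] by simp
  qed
qed

lemma constant_imp_deriv_zero:
  assumes "open I" "\<And>s. s \<in> I \<Longrightarrow> f s = c" "s \<in> I"
  shows "deriv f s = (0::real)"
  by (rule DERIV_imp_deriv, rule has_field_derivative_transform_within_open[OF DERIV_const assms(1,3)])
     (use assms(2) in auto)

lemma C2_on_const: "C2_on I (\<lambda>s. c)" and C2_on_id: "C2_on I (\<lambda>s. s)"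
  by (simp_all add: C2_on_def)

text \<open>The flow of \<open>F3\<close> preserves e^z x, so the orbit of the line x = c is a level
  set of this function; it is the coordinate plane x = 0 exactly when c = 0.\<close>

lemma inv_surface_vertical_plane:
  "inv_surface 0 0 (\<lambda>s. c) (\<lambda>s. s) ` strip UNIV = {p. exp (p$3) * p$1 = c}"
proof (intro equalityI subsetI)
  fix q :: "real^3" assume "q \<in> {p. exp (p$3) * p$1 = c}"
  \<comment> \<open>The parameters solve u = z and e^u s = y.\<close>
  then have "q = inv_surface 0 0 (\<lambda>s. c) (\<lambda>s. s) (vector [q$3, exp (- q$3) * q$2])"
    by (auto simp: inv_surface_def vec_eq_iff forall_3 exp_minus field_simps)
  then show "q \<in> inv_surface 0 0 (\<lambda>s. c) (\<lambda>s. s) ` strip UNIV"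
    by (auto simp: strip_def)
qed (auto simp: inv_surface_def exp_minus)

lemma inv_surface_horizontal_plane:
  "inv_surface 0 0 (\<lambda>s. s) (\<lambda>s. c) ` strip UNIV = {p. exp (- (p$3)) * p$2 = c}"
proof (intro equalityI subsetI)
  fix q :: "real^3" assume "q \<in> {p. exp (- (p$3)) * p$2 = c}"
  then have "q = inv_surface 0 0 (\<lambda>s. s) (\<lambda>s. c) (vector [q$3, exp (q$3) * q$1])"
    by (auto simp: inv_surface_def vec_eq_iff forall_3 exp_minus field_simps)
  then show "q \<in> inv_surface 0 0 (\<lambda>s. s) (\<lambda>s. c) ` strip UNIV"
    by (auto simp: strip_def)
qed (auto simp: inv_surface_def exp_minus)

text \<open>If \<open>\<eta>t\<close> and \<open>lt\<close> both vanish, then V is a multiple of X,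
  hence tangent, and the pointwise condition is vacuous while translators are just minimal surfaces.
  The plain equivalence therefore excludes this case, and the version with minimality covers it. For
  the same reason the statement on planes asks for a direction that is not a multiple of
  \<open>F3\<close>.\<close>

theorem mainTheorem5:
  fixes a b \<eta> l \<mu> \<eta>t lt :: real and I :: "real set"
    and X V :: "real^3 \<Rightarrow> real^3" and x y :: "real \<Rightarrow> real"
  assumes X: "X = killing a b 1"
    and V: "V = killing \<eta> l \<mu>"
    and \<eta>t: "\<eta>t = \<eta> - \<mu> * a"
    and lt: "lt = l - \<mu> * b"
    and I: "open I" "is_interval I" "I \<noteq> {}"
    and \<gamma>: "arclength_curve I x y"
  shows
    "V = (\<lambda>p. \<mu> *\<^sub>R X p + \<eta>t *\<^sub>R F1 p + lt *\<^sub>R F2 p) \<and>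
     (((\<eta>t, lt) \<noteq> (0, 0) \<longrightarrow>
       (invariant_translator_on sol_metric X V (strip I) (inv_surface a b x y) \<longleftrightarrow>
        (\<forall>s\<in>I. lt * deriv x s = 0 \<and> \<eta>t * deriv y s = 0))) \<and>
      (invariant_translator_on sol_metric X V (strip I) (inv_surface a b x y) \<longleftrightarrow>
        minimal_on sol_metric (strip I) (inv_surface a b x y) \<and>
        (\<forall>s\<in>I. lt * deriv x s = 0 \<and> \<eta>t * deriv y s = 0))) \<and>
     (\<forall>s\<in>I. \<not> (deriv x s = 0 \<and> deriv y s = 0)) \<and>
     ((\<exists>x1 y1. arclength_curve I x1 y1 \<and>
         invariant_translator_on sol_metric X V (strip I) (inv_surface a b x1 y1)) \<longleftrightarrow>
       lt * \<eta>t = 0) \<and>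
     (invariant_translator_on sol_metric X V (strip I) (inv_surface a b x y) \<longrightarrow>
       (lt \<noteq> 0 \<longrightarrow> (\<forall>s\<in>I. deriv x s = 0)) \<and>
       (\<eta>t \<noteq> 0 \<longrightarrow> (\<forall>s\<in>I. deriv y s = 0))) \<and>
     ((\<exists>\<eta>1 l1 \<mu>1. (\<eta>1, l1) \<noteq> (0, 0) \<and>
         invariant_translator_on sol_metric F3 (killing \<eta>1 l1 \<mu>1) (strip I)
           (inv_surface 0 0 x y)) \<longleftrightarrow>
       (\<exists>c0. (\<forall>s\<in>I. x s = c0) \<or> (\<forall>s\<in>I. y s = c0))) \<and>
     (\<forall>c0. inv_surface 0 0 (\<lambda>s. c0) (\<lambda>s. s) ` strip UNIV = {p. exp (p$3) * p$1 = c0} \<and>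
           inv_surface 0 0 (\<lambda>s. s) (\<lambda>s. c0) ` strip UNIV = {p. exp (- (p$3)) * p$2 = c0})"
proof -
  note surf = sol_invariant_surface.intro[OF I(1)]
  interpret sol_invariant_surface a b x y I by (rule surf[OF \<gamma>])
  interpret F3: sol_invariant_surface 0 0 x y I by (rule surf[OF \<gamma>])
  have C2: "C2_on I x" "C2_on I y" using \<gamma> by (simp_all add: arclength_curve_iff)
  have F3_killing: "F3 = killing 0 0 1" by (simp add: killing_def fun_eq_iff)
  have split: "V = (\<lambda>p. \<mu> *\<^sub>R X p + \<eta>t *\<^sub>R F1 p + lt *\<^sub>R F2 p)"
    by (simp add: fun_eq_iff X V \<eta>t lt killing_def algebra_simps)
  have iff: "invariant_translator_on sol_metric X V (strip I) (inv_surface a b x1 y1) \<longleftrightarrow>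
      minimal_on sol_metric (strip I) (inv_surface a b x1 y1) \<and>
      (\<forall>s\<in>I. lt * deriv x1 s = 0 \<and> \<eta>t * deriv y1 s = 0)"
    if "arclength_curve I x1 y1" for x1 y1
    unfolding X V \<eta>t lt using sol_invariant_surface.invariant_translator_iff[OF surf[OF that]] .
  have regular: "\<forall>s\<in>I. \<not> (deriv x s = 0 \<and> deriv y s = 0)"
    if "arclength_curve I x y" for x y
    using sol_invariant_surface.unit_speed[OF surf[OF that]] by fastforce
  have minimal: "minimal_on sol_metric (strip I) (inv_surface a b x y)"
    if "\<forall>s\<in>I. lt * deriv x s = 0 \<and> \<eta>t * deriv y s = 0" "(\<eta>t, lt) \<noteq> (0, 0)"
    using that by (intro minimal_if_horizontal_or_vertical) auto
  have lines: "arclength_curve I (\<lambda>s. 0) (\<lambda>s. s)" "arclength_curve I (\<lambda>s. s) (\<lambda>s. 0)"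
    by (simp_all add: arclength_curve_iff C2_on_const C2_on_id)
  have exists: "(\<exists>x1 y1. arclength_curve I x1 y1 \<and>
      invariant_translator_on sol_metric X V (strip I) (inv_surface a b x1 y1)) \<longleftrightarrow> lt * \<eta>t = 0"
  proof
    assume "\<exists>x1 y1. arclength_curve I x1 y1 \<and>
      invariant_translator_on sol_metric X V (strip I) (inv_surface a b x1 y1)"
    then obtain x1 y1 where c: "arclength_curve I x1 y1"
      and "invariant_translator_on sol_metric X V (strip I) (inv_surface a b x1 y1)" by blast
    then have "\<forall>s\<in>I. lt * deriv x1 s = 0 \<and> \<eta>t * deriv y1 s = 0" using iff by blast
    \<comment> \<open>At a point of the nonempty \<open>I\<close> one of the two derivatives is
      nonzero, which kills its coefficient.\<close>
    then show "lt * \<eta>t = 0" using regular[OF c] I(3) by auto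
  next
    assume "lt * \<eta>t = 0"
    \<comment> \<open>The witnesses are unit-speed coordinate lines: x constant if
      \<open>\<eta>t\<close> vanishes, y constant if \<open>lt\<close> vanishes.\<close>
    then consider "\<eta>t = 0" | "lt = 0" by auto
    then show "\<exists>x1 y1. arclength_curve I x1 y1 \<and>
      invariant_translator_on sol_metric X V (strip I) (inv_surface a b x1 y1)"
    proof cases
      case 1
      then have "invariant_translator_on sol_metric X V (strip I) (inv_surface a b (\<lambda>s. 0) (\<lambda>s. s))"
        unfolding iff[OF lines(1)]
        using sol_invariant_surface.minimal_if_horizontal_or_vertical[OF surf[OF lines(1)]] by simp
      then show ?thesis using lines(1) by blast
    next
      case 2
      then have "invariant_translator_on sol_metric X V (strip I) (inv_surface a b (\<lambda>s. s) (\<lambda>s. 0))"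
        unfolding iff[OF lines(2)]
        using sol_invariant_surface.minimal_if_horizontal_or_vertical[OF surf[OF lines(2)]] by simp
      then show ?thesis using lines(2) by blast
    qed
  qed
  have planes: "(\<exists>\<eta>1 l1 \<mu>1. (\<eta>1, l1) \<noteq> (0, 0) \<and>
      invariant_translator_on sol_metric F3 (killing \<eta>1 l1 \<mu>1) (strip I) (inv_surface 0 0 x y)) \<longleftrightarrow>
    (\<exists>c0. (\<forall>s\<in>I. x s = c0) \<or> (\<forall>s\<in>I. y s = c0))" (is "?L \<longleftrightarrow> ?R")
  proof
    assume ?L
    then have "(\<forall>s\<in>I. deriv x s = 0) \<or> (\<forall>s\<in>I. deriv y s = 0)"
      unfolding F3_killing F3.invariant_translator_iff by auto
    then show ?R
      using deriv_zero_imp_constant[OF I(2)] C2 by blast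
  next
    assume ?R
    then have *: "(\<forall>s\<in>I. deriv x s = 0) \<or> (\<forall>s\<in>I. deriv y s = 0)"
      using constant_imp_deriv_zero[OF I(1)] by blast
    note min = F3.minimal_if_horizontal_or_vertical[OF *]
    from * show ?L
    proof
      \<comment> \<open>The direction chosen is \<open>F2\<close>, up to a multiple of
        \<open>F3\<close>: it is tangent to the surface when x is constant. In the other case
        \<open>F1\<close> takes its place.\<close>
      assume "\<forall>s\<in>I. deriv x s = 0"
      then show ?L
        unfolding F3_killing F3.invariant_translator_iff using min
        by (intro exI[of _ 0] exI[of _ 1]) simp
    next
      assume "\<forall>s\<in>I. deriv y s = 0"
      then show ?L
        unfolding F3_killing F3.invariant_translator_iff using min
        by (intro exI[of _ 1] exI[of _ 0]) simp
    qed
  qed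
  note iff\<gamma> = iff[OF \<gamma>]
  have directions: "invariant_translator_on sol_metric X V (strip I) (inv_surface a b x y) \<longrightarrow>
      (lt \<noteq> 0 \<longrightarrow> (\<forall>s\<in>I. deriv x s = 0)) \<and> (\<eta>t \<noteq> 0 \<longrightarrow> (\<forall>s\<in>I. deriv y s = 0))"
    unfolding iff\<gamma> by auto
  have nontrivial: "(\<eta>t, lt) \<noteq> (0, 0) \<longrightarrow>
      (invariant_translator_on sol_metric X V (strip I) (inv_surface a b x y) \<longleftrightarrow>
        (\<forall>s\<in>I. lt * deriv x s = 0 \<and> \<eta>t * deriv y s = 0))"
    unfolding iff\<gamma> using minimal by blast
  show ?thesis
    by (rule conjI[OF split conjI[OF conjI[OF nontrivial iff\<gamma>] conjI[OF regular[OF \<gamma>]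
      conjI[OF exists conjI[OF directions conjI[OF planes allI[OF conjI[OF
        inv_surface_vertical_plane inv_surface_horizontal_plane]]]]]]]])
qed

end
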